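(* Let $G$ be a group and let $\mathcal{R}=\mathcal{R}_e \rtimes_{\sigma} G$ be a skew group ring with $\mathcal{R}_e$ commutative. The following two assertions are equivalent: (i) $\mathcal{R}_e$ is a maximal commutative and $G$-simple subring in $\mathcal{R}$. (ii) $\mathcal{R}=\mathcal{R}_e \rtimes_{\sigma} G$ is a simple ring.
   Context: All rings are associative and unital; $G$ is an arbitrary group with neutral element $e$. Given a ring $\mathcal{R}_e$ and a group homomorphism $\sigma: G\to \mathrm{Aut}(\mathcal{R}_e)$, $g\mapsto\sigma_g$, the skew group ring $\mathcal{R}_e\rtimes_\sigma G$ is the free left $\mathcal{R}_e$-module with basis $\{u_g\}_{g\in G}$, with multiplication determined by $(a\,u_g)(b\,u_h)=a\,\sigma_g(b)\,u_{gh}$ for $a,b\in\mathcal{R}_e$, $g,h\in G$; $\mathcal{R}_e$ is identified with the subring $\mathcal{R}_e u_e$. A commutative subring $S$ of $\mathcal{R}$ is maximal commutative in $\mathcal{R}$ if every element of $\mathcal{R}$ commuting with all of $S$ lies in $S$. Ideals are two-sided. A ring is simple if it has no ideals other than $\{0\}$ and itself. An ideal $I$ of $\mathcal{R}_e$ is $G$-invariant if $\sigma_g(I)\subseteq I$ for each $g\in G$; $\mathcal{R}_e$ is $G$-simple if it has no $G$-invariant ideals other than $\{0\}$ and $\mathcal{R}_e$. *)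

theory Defs
  imports "HOL-Algebra.Bij" "HOL-Algebra.QuotRing" "HOL-Algebra.Subrings"
begin

text \<open>The automorphism group of a ring, built as \<^const>\<open>AutoGroup\<close> is for groups.\<close>

definition ring_AutoGroup :: "('r, 'm) ring_scheme \<Rightarrow> ('r \<Rightarrow> 'r) monoid"
  where "ring_AutoGroup R =
    BijGroup (carrier R) \<lparr>carrier := ring_iso R R \<inter> Bij (carrier R)\<rparr>"

text \<open>
  An element \<open>\<Sum>g. a g u\<^sub>g\<close> of the skew group ring is represented by its finitely supported
  coefficient function \<open>a\<close>, taken to be \<^const>\<open>undefined\<close> off the carrier of the group so
  that equality of elements is equality of functions.
\<close>

definition skew_support ::
  "('g, 'n) monoid_scheme \<Rightarrow> ('r, 'm) ring_scheme \<Rightarrow> ('g \<Rightarrow> 'r) \<Rightarrow> 'g set"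
  where "skew_support G R a = {g \<in> carrier G. a g \<noteq> \<zero>\<^bsub>R\<^esub>}"

definition skew_monom ::
  "('g, 'n) monoid_scheme \<Rightarrow> ('r, 'm) ring_scheme \<Rightarrow> 'r \<Rightarrow> 'g \<Rightarrow> 'g \<Rightarrow> 'r"
  where "skew_monom G R r g = (\<lambda>h \<in> carrier G. if h = g then r else \<zero>\<^bsub>R\<^esub>)"

text \<open>
  Extending \<open>(a u\<^sub>g)(b u\<^sub>h) = a \<sigma>\<^sub>g(b) u\<^sub>g\<^sub>h\<close> biadditively, the coefficient of \<open>u\<^sub>k\<close> in a product
  collects the pairs with \<open>g h = k\<close>, that is, \<open>h = g\<inverse> k\<close>; see \<open>skew_monom_mult\<close> and
  \<open>skew_group_ring_is_ring\<close> below.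
\<close>

definition skew_group_ring ::
  "('r, 'm) ring_scheme \<Rightarrow> ('g, 'n) monoid_scheme \<Rightarrow> ('g \<Rightarrow> 'r \<Rightarrow> 'r) \<Rightarrow> ('g \<Rightarrow> 'r) ring"
  where "skew_group_ring R G \<sigma> =
    \<lparr>carrier = {a \<in> carrier G \<rightarrow>\<^sub>E carrier R. finite (skew_support G R a)},
     mult = (\<lambda>a b. \<lambda>k \<in> carrier G.
       \<Oplus>\<^bsub>R\<^esub>g \<in> skew_support G R a. a g \<otimes>\<^bsub>R\<^esub> \<sigma> g (b (inv\<^bsub>G\<^esub> g \<otimes>\<^bsub>G\<^esub> k))),
     one = skew_monom G R \<one>\<^bsub>R\<^esub> \<one>\<^bsub>G\<^esub>,
     zero = (\<lambda>g \<in> carrier G. \<zero>\<^bsub>R\<^esub>),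
     add = (\<lambda>a b. \<lambda>g \<in> carrier G. a g \<oplus>\<^bsub>R\<^esub> b g)\<rparr>"

text \<open>The copy \<open>R u\<^sub>e\<close> of the coefficient ring inside the skew group ring.\<close>

definition skew_coeff_ring ::
  "('r, 'm) ring_scheme \<Rightarrow> ('g, 'n) monoid_scheme \<Rightarrow> ('g \<Rightarrow> 'r) set"
  where "skew_coeff_ring R G = (\<lambda>r. skew_monom G R r \<one>\<^bsub>G\<^esub>) ` carrier R"

definition maximal_commutative :: "'a set \<Rightarrow> ('a, 'm) ring_scheme \<Rightarrow> bool"
  where "maximal_commutative S R \<longleftrightarrow> subcring S R \<and>
    (\<forall>x \<in> carrier R. (\<forall>s \<in> S. x \<otimes>\<^bsub>R\<^esub> s = s \<otimes>\<^bsub>R\<^esub> x) \<longrightarrow> x \<in> S)"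

text \<open>
  In the next two notions the zero ring is not excluded.  \<^const>\<open>ideal\<close> means two-sided ideal.
\<close>

definition simple_ring :: "('a, 'm) ring_scheme \<Rightarrow> bool"
  where "simple_ring R \<longleftrightarrow> ring R \<and> (\<forall>I. ideal I R \<longrightarrow> I = {\<zero>\<^bsub>R\<^esub>} \<or> I = carrier R)"

definition G_simple ::
  "('g, 'n) monoid_scheme \<Rightarrow> ('g \<Rightarrow> 'r \<Rightarrow> 'r) \<Rightarrow> ('r, 'm) ring_scheme \<Rightarrow> bool"
  where "G_simple G \<sigma> R \<longleftrightarrow> ring R \<and>
    (\<forall>I. ideal I R \<and> (\<forall>g \<in> carrier G. \<sigma> g ` I \<subseteq> I) \<longrightarrow> I = {\<zero>\<^bsub>R\<^esub>} \<or> I = carrier R)"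


lemma (in abelian_monoid) finsum_swap:
  assumes "finite A" "finite B" "\<And>a b. a \<in> A \<Longrightarrow> b \<in> B \<Longrightarrow> f a b \<in> carrier G"
  shows "(\<Oplus>a\<in>A. \<Oplus>b\<in>B. f a b) = (\<Oplus>b\<in>B. \<Oplus>a\<in>A. f a b)"
  using assms(1,3)
proof (induction A rule: finite_induct)
  case empty
  then show ?case by simp
next
  case (insert x F)
  have "(\<Oplus>a\<in>insert x F. \<Oplus>b\<in>B. f a b) = (\<Oplus>b\<in>B. f x b) \<oplus> (\<Oplus>a\<in>F. \<Oplus>b\<in>B. f a b)"
    using insert by (intro finsum_insert) (auto intro!: finsum_closed)
  also have "\<dots> = (\<Oplus>b\<in>B. f x b) \<oplus> (\<Oplus>b\<in>B. \<Oplus>a\<in>F. f a b)"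
    using insert by simp
  also have "\<dots> = (\<Oplus>b\<in>B. f x b \<oplus> (\<Oplus>a\<in>F. f a b))"
    using insert by (intro finsum_addf[symmetric]) (auto intro!: finsum_closed)
  also have "\<dots> = (\<Oplus>b\<in>B. \<Oplus>a\<in>insert x F. f a b)"
    using insert by (intro finsum_cong') (auto intro!: finsum_closed finsum_insert[symmetric])
  finally show ?case .
qed

locale skew_group_ring_data = G: group G + R: ring R
  for G :: "('g, 'n) monoid_scheme" (structure) and R :: "('r, 'm) ring_scheme" (structure) +
  fixes \<sigma> :: "'g \<Rightarrow> 'r \<Rightarrow> 'r"
  assumes \<sigma>_hom: "\<sigma> \<in> hom G (ring_AutoGroup R)"
begin

abbreviation "S \<equiv> skew_group_ring R G \<sigma>"
abbreviation "supp \<equiv> skew_support G R"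

lemma \<sigma>_ring_hom: "g \<in> carrier G \<Longrightarrow> \<sigma> g \<in> ring_hom R R"
  using \<sigma>_hom by (auto simp: hom_def ring_AutoGroup_def ring_iso_def)

lemma \<sigma>_closed: "g \<in> carrier G \<Longrightarrow> r \<in> carrier R \<Longrightarrow> \<sigma> g r \<in> carrier R"
  using \<sigma>_ring_hom ring_hom_closed by fast

lemma \<sigma>_ring_hom_ring: "g \<in> carrier G \<Longrightarrow> ring_hom_ring R R (\<sigma> g)"
  using \<sigma>_ring_hom R.ring_axioms by (simp add: ring_hom_ringI2)

lemma \<sigma>_zero: "g \<in> carrier G \<Longrightarrow> \<sigma> g \<zero>\<^bsub>R\<^esub> = \<zero>\<^bsub>R\<^esub>"
  by (rule ring_hom_zero[OF \<sigma>_ring_hom R.ring_axioms R.ring_axioms])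

lemma \<sigma>_mult_group:
  assumes "g \<in> carrier G" "h \<in> carrier G" "r \<in> carrier R"
  shows "\<sigma> (g \<otimes>\<^bsub>G\<^esub> h) r = \<sigma> g (\<sigma> h r)"
proof -
  have *: "\<sigma> g \<in> Bij (carrier R)" "\<sigma> h \<in> Bij (carrier R)"
    using \<sigma>_hom assms by (auto simp: hom_def ring_AutoGroup_def)
  have "\<sigma> (g \<otimes>\<^bsub>G\<^esub> h) = \<sigma> g \<otimes>\<^bsub>ring_AutoGroup R\<^esub> \<sigma> h"
    using \<sigma>_hom assms by (auto simp: hom_def)
  also have "\<dots> = compose (carrier R) (\<sigma> g) (\<sigma> h)"
    using * by (simp add: ring_AutoGroup_def BijGroup_def)
  finally show ?thesis using assms by (simp add: compose_def)
qed

lemma \<sigma>_one: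
  assumes "r \<in> carrier R"
  shows "\<sigma> \<one>\<^bsub>G\<^esub> r = r"
proof -
  have "\<sigma> \<one>\<^bsub>G\<^esub> (\<sigma> \<one>\<^bsub>G\<^esub> r) = \<sigma> \<one>\<^bsub>G\<^esub> r"
    using \<sigma>_mult_group[of "\<one>\<^bsub>G\<^esub>" "\<one>\<^bsub>G\<^esub>" r] assms by simp
  moreover have "inj_on (\<sigma> \<one>\<^bsub>G\<^esub>) (carrier R)"
    using \<sigma>_hom G.one_closed
    by (auto simp: hom_def ring_AutoGroup_def Bij_def bij_betw_def dest!: funcset_mem)
  ultimately show ?thesis
    using assms \<sigma>_closed by (meson G.one_closed inj_onD)
qed

lemma S_memI:
  "a \<in> carrier G \<rightarrow>\<^sub>E carrier R \<Longrightarrow> finite (supp a) \<Longrightarrow> a \<in> carrier S"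
  by (simp add: skew_group_ring_def)

lemma S_funcset: "a \<in> carrier S \<Longrightarrow> a \<in> carrier G \<rightarrow>\<^sub>E carrier R"
  by (simp add: skew_group_ring_def)

lemma S_closed: "a \<in> carrier S \<Longrightarrow> g \<in> carrier G \<Longrightarrow> a g \<in> carrier R"
  by (auto simp: skew_group_ring_def)

lemma S_finite: "a \<in> carrier S \<Longrightarrow> finite (supp a)"
  by (simp add: skew_group_ring_def)

lemma supp_subset: "supp a \<subseteq> carrier G"
  by (auto simp: skew_support_def)

lemma supp_iff: "g \<in> carrier G \<Longrightarrow> g \<in> supp a \<longleftrightarrow> a g \<noteq> \<zero>\<^bsub>R\<^esub>"
  by (simp add: skew_support_def)

lemma S_eqI:
  assumes "a \<in> carrier S" "b \<in> carrier S" "\<And>g. g \<in> carrier G \<Longrightarrow> a g = b g"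
  shows "a = b"
  using PiE_ext[OF S_funcset S_funcset] assms by blast

lemma S_add_apply: "g \<in> carrier G \<Longrightarrow> (a \<oplus>\<^bsub>S\<^esub> b) g = a g \<oplus>\<^bsub>R\<^esub> b g"
  by (simp add: skew_group_ring_def)

lemma S_zero_apply: "g \<in> carrier G \<Longrightarrow> \<zero>\<^bsub>S\<^esub> g = \<zero>\<^bsub>R\<^esub>"
  by (simp add: skew_group_ring_def)

lemma S_term_closed:
  assumes "a \<in> carrier S" "b \<in> carrier S" "g \<in> carrier G" "k \<in> carrier G"
  shows "a g \<otimes>\<^bsub>R\<^esub> \<sigma> g (b (inv\<^bsub>G\<^esub> g \<otimes>\<^bsub>G\<^esub> k)) \<in> carrier R"
  using assms by (intro R.m_closed \<sigma>_closed S_closed) auto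

lemma S_mult_apply:
  assumes ab: "a \<in> carrier S" "b \<in> carrier S" and k: "k \<in> carrier G"
    and A: "finite A" "supp a \<subseteq> A" "A \<subseteq> carrier G"
  shows "(a \<otimes>\<^bsub>S\<^esub> b) k = (\<Oplus>\<^bsub>R\<^esub>g \<in> A. a g \<otimes>\<^bsub>R\<^esub> \<sigma> g (b (inv\<^bsub>G\<^esub> g \<otimes>\<^bsub>G\<^esub> k)))"
proof -
  have "(a \<otimes>\<^bsub>S\<^esub> b) k = (\<Oplus>\<^bsub>R\<^esub>g \<in> supp a. a g \<otimes>\<^bsub>R\<^esub> \<sigma> g (b (inv\<^bsub>G\<^esub> g \<otimes>\<^bsub>G\<^esub> k)))"
    using k by (simp add: skew_group_ring_def)
  also have "\<dots> = (\<Oplus>\<^bsub>R\<^esub>g \<in> A. a g \<otimes>\<^bsub>R\<^esub> \<sigma> g (b (inv\<^bsub>G\<^esub> g \<otimes>\<^bsub>G\<^esub> k)))"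
  proof (rule R.add.finprod_mono_neutral_cong_left)
    fix g assume g: "g \<in> A - supp a"
    then have gG: "g \<in> carrier G" and "a g = \<zero>\<^bsub>R\<^esub>"
      using A(3) by (auto simp: skew_support_def)
    then show "a g \<otimes>\<^bsub>R\<^esub> \<sigma> g (b (inv\<^bsub>G\<^esub> g \<otimes>\<^bsub>G\<^esub> k)) = \<zero>\<^bsub>R\<^esub>"
      using k ab by (simp add: \<sigma>_closed S_closed)
  qed (use A S_term_closed[OF ab _ k] in auto)
  finally show ?thesis .
qed

lemma S_mult_supp:
  assumes ab: "a \<in> carrier S" "b \<in> carrier S"
  shows "supp (a \<otimes>\<^bsub>S\<^esub> b) \<subseteq> (\<lambda>(g, h). g \<otimes>\<^bsub>G\<^esub> h) ` (supp a \<times> supp b)"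
proof
  fix k assume k: "k \<in> supp (a \<otimes>\<^bsub>S\<^esub> b)"
  then have kG: "k \<in> carrier G" and nz: "(a \<otimes>\<^bsub>S\<^esub> b) k \<noteq> \<zero>\<^bsub>R\<^esub>"
    by (auto simp: skew_support_def)
  have "\<exists>g \<in> supp a. inv\<^bsub>G\<^esub> g \<otimes>\<^bsub>G\<^esub> k \<in> supp b"
  proof (rule ccontr)
    assume neg: "\<not> ?thesis"
    have "(a \<otimes>\<^bsub>S\<^esub> b) k = (\<Oplus>\<^bsub>R\<^esub>g \<in> supp a. a g \<otimes>\<^bsub>R\<^esub> \<sigma> g (b (inv\<^bsub>G\<^esub> g \<otimes>\<^bsub>G\<^esub> k)))"
      using S_mult_apply[OF ab kG S_finite[OF ab(1)]] supp_subset by auto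
    also have "\<dots> = (\<Oplus>\<^bsub>R\<^esub>g \<in> supp a. \<zero>\<^bsub>R\<^esub>)"
    proof (rule R.finsum_cong')
      fix g assume g: "g \<in> supp a"
      then have gG: "g \<in> carrier G" using supp_subset by auto
      then have "b (inv\<^bsub>G\<^esub> g \<otimes>\<^bsub>G\<^esub> k) = \<zero>\<^bsub>R\<^esub>"
        using neg g kG by (auto simp: skew_support_def)
      then show "a g \<otimes>\<^bsub>R\<^esub> \<sigma> g (b (inv\<^bsub>G\<^esub> g \<otimes>\<^bsub>G\<^esub> k)) = \<zero>\<^bsub>R\<^esub>"
        using gG ab by (simp add: \<sigma>_zero S_closed)
    qed auto
    also have "\<dots> = \<zero>\<^bsub>R\<^esub>" by (simp add: R.add.finprod_one_eqI)
    finally show False using nz by simp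
  qed
  then obtain g where g: "g \<in> supp a" "inv\<^bsub>G\<^esub> g \<otimes>\<^bsub>G\<^esub> k \<in> supp b" by auto
  moreover have "g \<otimes>\<^bsub>G\<^esub> (inv\<^bsub>G\<^esub> g \<otimes>\<^bsub>G\<^esub> k) = k"
    using g(1) kG supp_subset[of a] by (auto simp: G.m_assoc[symmetric])
  ultimately show "k \<in> (\<lambda>(g, h). g \<otimes>\<^bsub>G\<^esub> h) ` (supp a \<times> supp b)"
    by (force intro: rev_image_eqI[of "(g, inv\<^bsub>G\<^esub> g \<otimes>\<^bsub>G\<^esub> k)"])
qed

lemma S_mult_closed:
  assumes ab: "a \<in> carrier S" "b \<in> carrier S"
  shows "a \<otimes>\<^bsub>S\<^esub> b \<in> carrier S"
proof (rule S_memI)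
  show "finite (supp (a \<otimes>\<^bsub>S\<^esub> b))"
    by (rule finite_subset[OF S_mult_supp[OF ab]]) (simp add: S_finite ab)
  show "a \<otimes>\<^bsub>S\<^esub> b \<in> carrier G \<rightarrow>\<^sub>E carrier R"
  proof (rule PiE_I)
    fix k assume k: "k \<in> carrier G"
    show "(a \<otimes>\<^bsub>S\<^esub> b) k \<in> carrier R"
      unfolding S_mult_apply[OF ab k S_finite[OF ab(1)] order_refl supp_subset]
      using supp_subset[of a] S_term_closed[OF ab _ k] by (intro R.finsum_closed) auto
  qed (simp add: skew_group_ring_def)
qed

lemma S_add_closed:
  assumes ab: "a \<in> carrier S" "b \<in> carrier S"
  shows "a \<oplus>\<^bsub>S\<^esub> b \<in> carrier S"
proof (rule S_memI)
  have "supp (a \<oplus>\<^bsub>S\<^esub> b) \<subseteq> supp a \<union> supp b"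
    by (auto simp: skew_support_def S_add_apply)
  then show "finite (supp (a \<oplus>\<^bsub>S\<^esub> b))"
    by (rule finite_subset) (simp add: S_finite ab)
  show "a \<oplus>\<^bsub>S\<^esub> b \<in> carrier G \<rightarrow>\<^sub>E carrier R"
    using S_closed[OF ab(1)] S_closed[OF ab(2)] by (auto simp: skew_group_ring_def)
qed

lemma S_zero_closed: "\<zero>\<^bsub>S\<^esub> \<in> carrier S"
  by (rule S_memI) (auto simp: skew_group_ring_def skew_support_def)

lemma skew_monom_closed:
  assumes "r \<in> carrier R"
  shows "skew_monom G R r g \<in> carrier S"
proof (rule S_memI)
  show "finite (supp (skew_monom G R r g))"
    by (rule finite_subset[of _ "{g}"]) (auto simp: skew_support_def skew_monom_def)
qed (use assms in \<open>auto simp: skew_monom_def\<close>)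

lemma S_one: "\<one>\<^bsub>S\<^esub> = skew_monom G R \<one>\<^bsub>R\<^esub> \<one>\<^bsub>G\<^esub>"
  by (simp add: skew_group_ring_def)

lemma skew_monom_supp: "supp (skew_monom G R r g) \<subseteq> {g}"
  by (auto simp: skew_support_def skew_monom_def)

lemma skew_monom_mult_apply:
  assumes "r \<in> carrier R" "g \<in> carrier G" "b \<in> carrier S" "k \<in> carrier G"
  shows "(skew_monom G R r g \<otimes>\<^bsub>S\<^esub> b) k = r \<otimes>\<^bsub>R\<^esub> \<sigma> g (b (inv\<^bsub>G\<^esub> g \<otimes>\<^bsub>G\<^esub> k))"
proof -
  have "(skew_monom G R r g \<otimes>\<^bsub>S\<^esub> b) k = (\<Oplus>\<^bsub>R\<^esub>h \<in> {g}.
      skew_monom G R r g h \<otimes>\<^bsub>R\<^esub> \<sigma> h (b (inv\<^bsub>G\<^esub> h \<otimes>\<^bsub>G\<^esub> k)))"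
    using assms skew_monom_supp[of r g]
    by (intro S_mult_apply skew_monom_closed) auto
  also have "\<dots> = r \<otimes>\<^bsub>R\<^esub> \<sigma> g (b (inv\<^bsub>G\<^esub> g \<otimes>\<^bsub>G\<^esub> k))"
    using assms by (simp add: skew_monom_def \<sigma>_closed S_closed)
  finally show ?thesis .
qed

lemma skew_monom_mult:
  assumes "r \<in> carrier R" "s \<in> carrier R" "g \<in> carrier G" "h \<in> carrier G"
  shows "skew_monom G R r g \<otimes>\<^bsub>S\<^esub> skew_monom G R s h =
    skew_monom G R (r \<otimes>\<^bsub>R\<^esub> \<sigma> g s) (g \<otimes>\<^bsub>G\<^esub> h)"
proof (rule S_eqI)
  fix k assume k: "k \<in> carrier G"
  have "inv\<^bsub>G\<^esub> g \<otimes>\<^bsub>G\<^esub> k = h \<longleftrightarrow> k = g \<otimes>\<^bsub>G\<^esub> h"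
    using assms k by (metis G.inv_closed G.inv_solve_left)
  then show "(skew_monom G R r g \<otimes>\<^bsub>S\<^esub> skew_monom G R s h) k =
      skew_monom G R (r \<otimes>\<^bsub>R\<^esub> \<sigma> g s) (g \<otimes>\<^bsub>G\<^esub> h) k"
    using assms k
    by (simp add: skew_monom_mult_apply skew_monom_closed) (simp add: skew_monom_def \<sigma>_zero)
qed (use assms in \<open>auto intro!: S_mult_closed skew_monom_closed \<sigma>_closed\<close>)

lemma S_mult_assoc:
  assumes abc: "a \<in> carrier S" "b \<in> carrier S" "c \<in> carrier S"
  shows "(a \<otimes>\<^bsub>S\<^esub> b) \<otimes>\<^bsub>S\<^esub> c = a \<otimes>\<^bsub>S\<^esub> (b \<otimes>\<^bsub>S\<^esub> c)"
proof (rule S_eqI)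
  fix k assume k: "k \<in> carrier G"
  define X where "X = (\<lambda>(g, h). g \<otimes>\<^bsub>G\<^esub> h) ` (supp a \<times> supp b)"
  have X: "finite X" "X \<subseteq> carrier G" "supp (a \<otimes>\<^bsub>S\<^esub> b) \<subseteq> X"
    using S_mult_supp[OF abc(1,2)] supp_subset[of a] supp_subset[of b] S_finite abc
    by (auto simp: X_def)
  let ?t = "\<lambda>x. \<sigma> x (c (inv\<^bsub>G\<^esub> x \<otimes>\<^bsub>G\<^esub> k))"
  let ?u = "\<lambda>g x. \<sigma> g (b (inv\<^bsub>G\<^esub> g \<otimes>\<^bsub>G\<^esub> x))"
  have t: "?t x \<in> carrier R" if "x \<in> carrier G" for x
    using that k abc by (intro \<sigma>_closed S_closed) auto
  have u: "?u g x \<in> carrier R" if "g \<in> carrier G" "x \<in> carrier G" for g x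
    using that abc by (intro \<sigma>_closed S_closed) auto
  have ca: "a g \<in> carrier R" if "g \<in> carrier G" for g
    using that abc by (intro S_closed) auto
  have sa: "g \<in> carrier G" if "g \<in> supp a" for g using that supp_subset by auto
  have xX: "x \<in> carrier G" if "x \<in> X" for x using that X by auto
  have "((a \<otimes>\<^bsub>S\<^esub> b) \<otimes>\<^bsub>S\<^esub> c) k = (\<Oplus>\<^bsub>R\<^esub>x\<in>X. (a \<otimes>\<^bsub>S\<^esub> b) x \<otimes>\<^bsub>R\<^esub> ?t x)"
    using abc k X by (intro S_mult_apply S_mult_closed) auto
  also have "\<dots> = (\<Oplus>\<^bsub>R\<^esub>x\<in>X. \<Oplus>\<^bsub>R\<^esub>g\<in>supp a. a g \<otimes>\<^bsub>R\<^esub> (?u g x \<otimes>\<^bsub>R\<^esub> ?t x))"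
  proof (rule R.finsum_cong')
    fix x assume x: "x \<in> X"
    have "(a \<otimes>\<^bsub>S\<^esub> b) x \<otimes>\<^bsub>R\<^esub> ?t x = (\<Oplus>\<^bsub>R\<^esub>g\<in>supp a. a g \<otimes>\<^bsub>R\<^esub> ?u g x) \<otimes>\<^bsub>R\<^esub> ?t x"
      using abc S_finite supp_subset xX[OF x] by (subst S_mult_apply[where A = "supp a"]) auto
    also have "\<dots> = (\<Oplus>\<^bsub>R\<^esub>g\<in>supp a. a g \<otimes>\<^bsub>R\<^esub> ?u g x \<otimes>\<^bsub>R\<^esub> ?t x)"
      using abc S_finite xX[OF x] sa ca t u by (intro R.finsum_ldistr) auto
    also have "\<dots> = (\<Oplus>\<^bsub>R\<^esub>g\<in>supp a. a g \<otimes>\<^bsub>R\<^esub> (?u g x \<otimes>\<^bsub>R\<^esub> ?t x))"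
      using xX[OF x] sa ca t u by (intro R.finsum_cong') (auto simp: R.m_assoc)
    finally show "(a \<otimes>\<^bsub>S\<^esub> b) x \<otimes>\<^bsub>R\<^esub> ?t x = (\<Oplus>\<^bsub>R\<^esub>g\<in>supp a. a g \<otimes>\<^bsub>R\<^esub> (?u g x \<otimes>\<^bsub>R\<^esub> ?t x))" .
  qed (use xX sa ca t u in \<open>auto intro!: R.finsum_closed\<close>)
  also have "\<dots> = (\<Oplus>\<^bsub>R\<^esub>g\<in>supp a. \<Oplus>\<^bsub>R\<^esub>x\<in>X. a g \<otimes>\<^bsub>R\<^esub> (?u g x \<otimes>\<^bsub>R\<^esub> ?t x))"
    using X S_finite abc xX sa ca t u by (intro R.finsum_swap) auto
  also have "\<dots> = (\<Oplus>\<^bsub>R\<^esub>g\<in>supp a. a g \<otimes>\<^bsub>R\<^esub> \<sigma> g ((b \<otimes>\<^bsub>S\<^esub> c) (inv\<^bsub>G\<^esub> g \<otimes>\<^bsub>G\<^esub> k)))"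
  proof (rule R.finsum_cong')
    fix g assume g: "g \<in> supp a"
    then have gG: "g \<in> carrier G" using sa by auto
    interpret h: ring_hom_ring R R "\<sigma> g" by (rule \<sigma>_ring_hom_ring[OF gG])
    define Y where "Y = (\<lambda>x. inv\<^bsub>G\<^esub> g \<otimes>\<^bsub>G\<^esub> x) ` X"
    have inj: "inj_on (\<lambda>x. g \<otimes>\<^bsub>G\<^esub> x) Y"
      using gG xX by (auto simp: Y_def inj_on_def)
    have YX: "(\<lambda>x. g \<otimes>\<^bsub>G\<^esub> x) ` Y = X"
      using gG xX by (auto simp: Y_def image_image G.m_assoc[symmetric])
    have Y: "finite Y" "Y \<subseteq> carrier G" using X gG by (auto simp: Y_def)
    have bY: "supp b \<subseteq> Y"
    proof
      fix h assume h: "h \<in> supp b"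
      then have "h \<in> carrier G" using supp_subset by auto
      then have "inv\<^bsub>G\<^esub> g \<otimes>\<^bsub>G\<^esub> (g \<otimes>\<^bsub>G\<^esub> h) = h"
        using gG by (simp add: G.m_assoc[symmetric])
      moreover have "g \<otimes>\<^bsub>G\<^esub> h \<in> X" using g h by (auto simp: X_def)
      ultimately show "h \<in> Y" unfolding Y_def by force
    qed
    have yG: "y \<in> carrier G" if "y \<in> Y" for y using that Y by auto
    let ?v = "\<lambda>y. b y \<otimes>\<^bsub>R\<^esub> \<sigma> y (c (inv\<^bsub>G\<^esub> y \<otimes>\<^bsub>G\<^esub> (inv\<^bsub>G\<^esub> g \<otimes>\<^bsub>G\<^esub> k)))"
    have v: "?v y \<in> carrier R" if "y \<in> carrier G" for y
      using that abc gG k by (intro S_term_closed) auto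
    have "(\<Oplus>\<^bsub>R\<^esub>x\<in>X. a g \<otimes>\<^bsub>R\<^esub> (?u g x \<otimes>\<^bsub>R\<^esub> ?t x)) = a g \<otimes>\<^bsub>R\<^esub> (\<Oplus>\<^bsub>R\<^esub>x\<in>X. ?u g x \<otimes>\<^bsub>R\<^esub> ?t x)"
      using X gG xX ca t u by (intro R.finsum_rdistr[symmetric]) auto
    also have "(\<Oplus>\<^bsub>R\<^esub>x\<in>X. ?u g x \<otimes>\<^bsub>R\<^esub> ?t x) =
        (\<Oplus>\<^bsub>R\<^esub>y\<in>Y. ?u g (g \<otimes>\<^bsub>G\<^esub> y) \<otimes>\<^bsub>R\<^esub> ?t (g \<otimes>\<^bsub>G\<^esub> y))"
      unfolding YX[symmetric] using inj gG yG t u by (intro R.finsum_reindex) auto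
    also have "\<dots> = (\<Oplus>\<^bsub>R\<^esub>y\<in>Y. \<sigma> g (?v y))"
    proof (rule R.finsum_cong')
      fix y assume "y \<in> Y"
      then have y: "y \<in> carrier G" by (rule yG)
      have 1: "inv\<^bsub>G\<^esub> g \<otimes>\<^bsub>G\<^esub> (g \<otimes>\<^bsub>G\<^esub> y) = y"
        using y gG by (simp add: G.m_assoc[symmetric])
      have 2: "inv\<^bsub>G\<^esub> (g \<otimes>\<^bsub>G\<^esub> y) \<otimes>\<^bsub>G\<^esub> k = inv\<^bsub>G\<^esub> y \<otimes>\<^bsub>G\<^esub> (inv\<^bsub>G\<^esub> g \<otimes>\<^bsub>G\<^esub> k)"
        using y gG k by (simp add: G.inv_mult_group G.m_assoc)
      have 3: "c (inv\<^bsub>G\<^esub> y \<otimes>\<^bsub>G\<^esub> (inv\<^bsub>G\<^esub> g \<otimes>\<^bsub>G\<^esub> k)) \<in> carrier R" "b y \<in> carrier R"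
        using y gG k abc by (auto intro!: S_closed)
      show "?u g (g \<otimes>\<^bsub>G\<^esub> y) \<otimes>\<^bsub>R\<^esub> ?t (g \<otimes>\<^bsub>G\<^esub> y) = \<sigma> g (?v y)"
        unfolding 1 2 using y gG 3 by (simp add: \<sigma>_mult_group \<sigma>_closed)
    qed (use yG v gG \<sigma>_closed in auto)
    also have "\<dots> = \<sigma> g (\<Oplus>\<^bsub>R\<^esub>y\<in>Y. ?v y)"
      using v yG by (subst h.hom_finsum) (auto simp: comp_def)
    also have "(\<Oplus>\<^bsub>R\<^esub>y\<in>Y. ?v y) = (b \<otimes>\<^bsub>S\<^esub> c) (inv\<^bsub>G\<^esub> g \<otimes>\<^bsub>G\<^esub> k)"
      using abc gG k Y bY by (intro S_mult_apply[symmetric]) auto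
    finally show "(\<Oplus>\<^bsub>R\<^esub>x\<in>X. a g \<otimes>\<^bsub>R\<^esub> (?u g x \<otimes>\<^bsub>R\<^esub> ?t x)) =
      a g \<otimes>\<^bsub>R\<^esub> \<sigma> g ((b \<otimes>\<^bsub>S\<^esub> c) (inv\<^bsub>G\<^esub> g \<otimes>\<^bsub>G\<^esub> k))" .
  qed (use sa abc k in \<open>auto intro!: S_term_closed S_mult_closed\<close>)
  also have "\<dots> = (a \<otimes>\<^bsub>S\<^esub> (b \<otimes>\<^bsub>S\<^esub> c)) k"
    using abc k S_finite supp_subset by (intro S_mult_apply[symmetric] S_mult_closed) auto
  finally show "((a \<otimes>\<^bsub>S\<^esub> b) \<otimes>\<^bsub>S\<^esub> c) k = (a \<otimes>\<^bsub>S\<^esub> (b \<otimes>\<^bsub>S\<^esub> c)) k" .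
qed (use abc in \<open>auto intro!: S_mult_closed\<close>)

lemma S_one_left: "a \<in> carrier S \<Longrightarrow> \<one>\<^bsub>S\<^esub> \<otimes>\<^bsub>S\<^esub> a = a"
  unfolding S_one
  by (rule S_eqI) (auto intro!: S_mult_closed skew_monom_closed
      simp: skew_monom_mult_apply \<sigma>_one S_closed)

lemma S_one_right:
  assumes a: "a \<in> carrier S"
  shows "a \<otimes>\<^bsub>S\<^esub> \<one>\<^bsub>S\<^esub> = a"
proof (rule S_eqI)
  fix k assume k: "k \<in> carrier G"
  let ?A = "insert k (supp a)"
  have AG: "g \<in> carrier G" if "g \<in> ?A" for g using that k supp_subset[of a] by auto
  have "(a \<otimes>\<^bsub>S\<^esub> \<one>\<^bsub>S\<^esub>) k = (\<Oplus>\<^bsub>R\<^esub>g \<in> ?A. a g \<otimes>\<^bsub>R\<^esub> \<sigma> g (\<one>\<^bsub>S\<^esub> (inv\<^bsub>G\<^esub> g \<otimes>\<^bsub>G\<^esub> k)))"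
    using a k AG by (intro S_mult_apply) (auto simp: S_one S_finite skew_monom_closed)
  also have "\<dots> = (\<Oplus>\<^bsub>R\<^esub>g \<in> ?A. if k = g then a g else \<zero>\<^bsub>R\<^esub>)"
  proof (rule R.finsum_cong')
    fix g assume "g \<in> ?A"
    then have g: "g \<in> carrier G" by (rule AG)
    interpret h: ring_hom_ring R R "\<sigma> g" by (rule \<sigma>_ring_hom_ring[OF g])
    have "inv\<^bsub>G\<^esub> g \<otimes>\<^bsub>G\<^esub> k = \<one>\<^bsub>G\<^esub> \<longleftrightarrow> k = g"
      using g k by (metis G.inv_closed G.inv_solve_left G.one_closed G.r_one)
    then show "a g \<otimes>\<^bsub>R\<^esub> \<sigma> g (\<one>\<^bsub>S\<^esub> (inv\<^bsub>G\<^esub> g \<otimes>\<^bsub>G\<^esub> k)) = (if k = g then a g else \<zero>\<^bsub>R\<^esub>)"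
      using g k a by (simp add: S_one skew_monom_def S_closed)
  qed (use AG a S_closed in auto)
  also have "\<dots> = a k"
    using a k AG S_finite S_closed by (intro R.finsum_singleton) auto
  finally show "(a \<otimes>\<^bsub>S\<^esub> \<one>\<^bsub>S\<^esub>) k = a k" .
qed (use a in \<open>auto intro!: S_mult_closed simp: S_one skew_monom_closed\<close>)

lemma S_left_distrib:
  assumes abc: "a \<in> carrier S" "b \<in> carrier S" "c \<in> carrier S"
  shows "(a \<oplus>\<^bsub>S\<^esub> b) \<otimes>\<^bsub>S\<^esub> c = a \<otimes>\<^bsub>S\<^esub> c \<oplus>\<^bsub>S\<^esub> b \<otimes>\<^bsub>S\<^esub> c"
proof (rule S_eqI)
  fix k assume k: "k \<in> carrier G"
  let ?A = "supp a \<union> supp b"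
  have AG: "g \<in> carrier G" if "g \<in> ?A" for g using that supp_subset by auto
  have sub: "supp (a \<oplus>\<^bsub>S\<^esub> b) \<subseteq> ?A"
    by (auto simp: skew_support_def S_add_apply)
  let ?t = "\<lambda>g. \<sigma> g (c (inv\<^bsub>G\<^esub> g \<otimes>\<^bsub>G\<^esub> k))"
  have t: "?t g \<in> carrier R" if "g \<in> carrier G" for g
    using that k abc by (intro \<sigma>_closed S_closed) auto
  have "((a \<oplus>\<^bsub>S\<^esub> b) \<otimes>\<^bsub>S\<^esub> c) k = (\<Oplus>\<^bsub>R\<^esub>g \<in> ?A. (a \<oplus>\<^bsub>S\<^esub> b) g \<otimes>\<^bsub>R\<^esub> ?t g)"
    using abc k AG sub by (intro S_mult_apply S_add_closed) (auto simp: S_finite)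
  also have "\<dots> = (\<Oplus>\<^bsub>R\<^esub>g \<in> ?A. a g \<otimes>\<^bsub>R\<^esub> ?t g \<oplus>\<^bsub>R\<^esub> b g \<otimes>\<^bsub>R\<^esub> ?t g)"
    using AG t S_closed[OF abc(1)] S_closed[OF abc(2)]
    by (intro R.finsum_cong') (auto simp: S_add_apply R.l_distr)
  also have "\<dots> = (\<Oplus>\<^bsub>R\<^esub>g \<in> ?A. a g \<otimes>\<^bsub>R\<^esub> ?t g) \<oplus>\<^bsub>R\<^esub> (\<Oplus>\<^bsub>R\<^esub>g \<in> ?A. b g \<otimes>\<^bsub>R\<^esub> ?t g)"
    using AG t S_closed[OF abc(1)] S_closed[OF abc(2)] by (intro R.finsum_addf) auto
  also have "(\<Oplus>\<^bsub>R\<^esub>g \<in> ?A. a g \<otimes>\<^bsub>R\<^esub> ?t g) = (a \<otimes>\<^bsub>S\<^esub> c) k"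
    using abc k AG by (intro S_mult_apply[symmetric]) (auto simp: S_finite)
  also have "(\<Oplus>\<^bsub>R\<^esub>g \<in> ?A. b g \<otimes>\<^bsub>R\<^esub> ?t g) = (b \<otimes>\<^bsub>S\<^esub> c) k"
    using abc k AG by (intro S_mult_apply[symmetric]) (auto simp: S_finite)
  finally show "((a \<oplus>\<^bsub>S\<^esub> b) \<otimes>\<^bsub>S\<^esub> c) k = (a \<otimes>\<^bsub>S\<^esub> c \<oplus>\<^bsub>S\<^esub> b \<otimes>\<^bsub>S\<^esub> c) k"
    using k by (simp add: S_add_apply)
qed (use abc in \<open>auto intro!: S_mult_closed S_add_closed\<close>)

lemma S_right_distrib:
  assumes abc: "a \<in> carrier S" "b \<in> carrier S" "c \<in> carrier S"
  shows "c \<otimes>\<^bsub>S\<^esub> (a \<oplus>\<^bsub>S\<^esub> b) = c \<otimes>\<^bsub>S\<^esub> a \<oplus>\<^bsub>S\<^esub> c \<otimes>\<^bsub>S\<^esub> b"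
proof (rule S_eqI)
  fix k assume k: "k \<in> carrier G"
  let ?C = "supp c"
  have CG: "g \<in> carrier G" if "g \<in> ?C" for g using that supp_subset by auto
  let ?x = "\<lambda>d g. c g \<otimes>\<^bsub>R\<^esub> \<sigma> g (d (inv\<^bsub>G\<^esub> g \<otimes>\<^bsub>G\<^esub> k))"
  have m: "(c \<otimes>\<^bsub>S\<^esub> d) k = (\<Oplus>\<^bsub>R\<^esub>g \<in> ?C. ?x d g)" if "d \<in> carrier S" for d
    using that abc k CG by (intro S_mult_apply) (auto simp: S_finite)
  have "(c \<otimes>\<^bsub>S\<^esub> (a \<oplus>\<^bsub>S\<^esub> b)) k = (\<Oplus>\<^bsub>R\<^esub>g \<in> ?C. ?x (a \<oplus>\<^bsub>S\<^esub> b) g)"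
    using abc by (intro m S_add_closed)
  also have "\<dots> = (\<Oplus>\<^bsub>R\<^esub>g \<in> ?C. ?x a g \<oplus>\<^bsub>R\<^esub> ?x b g)"
  proof (rule R.finsum_cong')
    fix g assume "g \<in> ?C"
    then have g: "g \<in> carrier G" by (rule CG)
    interpret h: ring_hom_ring R R "\<sigma> g" by (rule \<sigma>_ring_hom_ring[OF g])
    show "?x (a \<oplus>\<^bsub>S\<^esub> b) g = ?x a g \<oplus>\<^bsub>R\<^esub> ?x b g"
      using g k abc by (simp add: S_add_apply S_closed R.r_distr)
  qed (use CG abc k S_term_closed in auto)
  also have "\<dots> = (\<Oplus>\<^bsub>R\<^esub>g \<in> ?C. ?x a g) \<oplus>\<^bsub>R\<^esub> (\<Oplus>\<^bsub>R\<^esub>g \<in> ?C. ?x b g)"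
    using CG abc k S_term_closed by (intro R.finsum_addf) auto
  finally show "(c \<otimes>\<^bsub>S\<^esub> (a \<oplus>\<^bsub>S\<^esub> b)) k = (c \<otimes>\<^bsub>S\<^esub> a \<oplus>\<^bsub>S\<^esub> c \<otimes>\<^bsub>S\<^esub> b) k"
    using k abc by (simp add: S_add_apply m)
qed (use abc in \<open>auto intro!: S_mult_closed S_add_closed\<close>)

theorem skew_group_ring_is_ring: "ring S"
proof (rule ringI)
  show "abelian_group S"
  proof (rule abelian_groupI)
    fix a assume a: "a \<in> carrier S"
    let ?n = "\<lambda>g \<in> carrier G. \<ominus>\<^bsub>R\<^esub> a g"
    have "supp ?n \<subseteq> supp a"
      by (auto simp: skew_support_def)
    then have n: "?n \<in> carrier S"
      using S_closed[OF a] finite_subset S_finite[OF a] by (intro S_memI) auto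
    have "?n \<oplus>\<^bsub>S\<^esub> a = \<zero>\<^bsub>S\<^esub>"
      using n a S_closed[OF a]
      by (intro S_eqI S_add_closed S_zero_closed) (auto simp: S_add_apply S_zero_apply R.l_neg)
    then show "\<exists>y \<in> carrier S. y \<oplus>\<^bsub>S\<^esub> a = \<zero>\<^bsub>S\<^esub>" using n by blast
  qed (auto intro!: S_eqI S_add_closed S_zero_closed
      simp: S_add_apply S_zero_apply S_closed R.a_ac)
  show "monoid S"
    by (rule monoidI)
      (auto simp: S_mult_closed S_one skew_monom_closed S_mult_assoc
        S_one_left[unfolded S_one] S_one_right[unfolded S_one])
qed (auto simp: S_left_distrib S_right_distrib)

end

end

theory Submission
  imports Defs
begin

text \<open>
  Write \<open>S\<close> for the skew group ring of \<open>R\<close> and \<open>G\<close>.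

  Suppose first that \<open>R\<close> is maximal commutative in \<open>S\<close> and \<open>G\<close>-simple, and let \<open>I\<close> be a nonzero
  ideal of \<open>S\<close>.  Choose a nonzero \<open>x \<in> I\<close> whose support has the least possible size; multiplying
  on the right by some \<open>u\<^sub>h\<close> moves the identity \<open>e\<close> into the support.  For \<open>r \<in> R\<close> the commutator
  \<open>r x - x r\<close> lies in \<open>I\<close>, its support is contained in that of \<open>x\<close>, and its coefficient at \<open>e\<close>
  vanishes because \<open>R\<close> is commutative.  By minimality the commutator is \<open>0\<close>.  So \<open>x\<close> commutes
  with \<open>R\<close> and hence lies in \<open>R\<close> (\<open>ideal_meets_coeff_ring\<close>).  Therefore \<open>I \<inter> R\<close>, which is a
  \<open>G\<close>-invariant ideal of \<open>R\<close> since \<open>u\<^sub>g r u\<^sub>g\<inverse> = \<sigma>\<^sub>g(r)\<close>, is nonzero.  It is thus all of \<open>R\<close>,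
  and \<open>1 \<in> I\<close>.

  Suppose conversely that \<open>S\<close> is simple.  A \<open>G\<close>-invariant ideal \<open>J\<close> of \<open>R\<close> generates the ideal of
  all elements of \<open>S\<close> with coefficients in \<open>J\<close> (\<open>coeff_ideal\<close>), so \<open>R\<close> is \<open>G\<close>-simple.  For
  maximal commutativity, let \<open>S\<close> act on the left \<open>S\<close>-module \<open>R\<close> by \<open>(a u\<^sub>g) \<cdot> s = a \<sigma>\<^sub>g(s)\<close>.  The
  annihilator is a two-sided ideal, and \<open>1\<close> acts as the identity, so the action is faithful
  (\<open>faithful_action\<close>).  If \<open>x\<close> commutes with \<open>R\<close> and \<open>c\<close> is its coefficient at \<open>g\<close>, then
  \<open>c \<sigma>\<^sub>g(s) = s c = c s\<close> for all \<open>s \<in> R\<close>, which says that \<open>c u\<^sub>g\<close> and \<open>c u\<^sub>e\<close> act in the same way.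
  They are therefore equal, and this forces \<open>c = 0\<close> unless \<open>g = e\<close>.
\<close>

section \<open>Ideals\<close>

text \<open>
  Negatives come for free because \<open>-a = (-1) a\<close>.
\<close>

lemma (in ring) ideal_if_closed:
  assumes "I \<subseteq> carrier R" "\<zero> \<in> I"
    and add: "\<And>a b. a \<in> I \<Longrightarrow> b \<in> I \<Longrightarrow> a \<oplus> b \<in> I"
    and l: "\<And>a x. a \<in> I \<Longrightarrow> x \<in> carrier R \<Longrightarrow> x \<otimes> a \<in> I"
    and r: "\<And>a x. a \<in> I \<Longrightarrow> x \<in> carrier R \<Longrightarrow> a \<otimes> x \<in> I"
  shows "ideal I R"
proof (rule idealI[OF ring_axioms _ l r])
  show "subgroup I (add_monoid R)"
  proof (rule add.subgroupI)
    fix a assume a: "a \<in> I"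
    then have "(\<ominus> \<one>) \<otimes> a = \<ominus> a"
      using assms(1) l_minus[of \<one> a] by auto
    with l[OF a, of "\<ominus> \<one>"] show "\<ominus> a \<in> I" by simp
  qed (use assms in auto)
qed

lemma (in ideal) finsum_in_ideal:
  assumes "\<And>i. i \<in> A \<Longrightarrow> f i \<in> I"
  shows "(\<Oplus>i\<in>A. f i) \<in> I"
  using assms
proof (induction A rule: infinite_finite_induct)
  case (insert i A)
  have "(\<Oplus>j\<in>insert i A. f j) = f i \<oplus> (\<Oplus>j\<in>A. f j)"
    using insert Icarr by (intro finsum_insert) auto
  then show ?case using insert by simp
qed (simp_all add: finsum_infinite)

section \<open>Monomials and the coefficient ring\<close>

context skew_group_ring_data
begin

lemma ring_S: "ring S"
  by (rule skew_group_ring_is_ring)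

sublocale S: ring S
  by (rule ring_S)

lemma skew_monom_apply:
  "h \<in> carrier G \<Longrightarrow> skew_monom G R r g h = (if h = g then r else \<zero>\<^bsub>R\<^esub>)"
  by (simp add: skew_monom_def)

lemma supp_empty_iff:
  assumes "x \<in> carrier S"
  shows "supp x = {} \<longleftrightarrow> x = \<zero>\<^bsub>S\<^esub>"
proof
  assume "supp x = {}"
  then show "x = \<zero>\<^bsub>S\<^esub>"
    using assms by (intro S_eqI) (auto simp: skew_support_def S_zero_apply)
qed (auto simp: skew_support_def S_zero_apply)

lemma S_minus_apply:
  assumes "a \<in> carrier S" "b \<in> carrier S" "g \<in> carrier G"
  shows "(a \<ominus>\<^bsub>S\<^esub> b) g = a g \<ominus>\<^bsub>R\<^esub> b g"
proof -
  have "(\<ominus>\<^bsub>S\<^esub> b) g \<oplus>\<^bsub>R\<^esub> b g = \<zero>\<^bsub>R\<^esub>"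
    using assms S_add_apply[of g "\<ominus>\<^bsub>S\<^esub> b" b] by (simp add: S.l_neg S_zero_apply)
  then have "(\<ominus>\<^bsub>S\<^esub> b) g = \<ominus>\<^bsub>R\<^esub> b g"
    using assms by (metis R.minus_equality S.a_inv_closed S_closed)
  then show ?thesis
    using assms by (simp add: a_minus_def S_add_apply)
qed

lemma mult_skew_monom_apply:
  assumes x: "x \<in> carrier S" and s: "s \<in> carrier R" and h: "h \<in> carrier G" and k: "k \<in> carrier G"
  shows "(x \<otimes>\<^bsub>S\<^esub> skew_monom G R s h) k =
    x (k \<otimes>\<^bsub>G\<^esub> inv\<^bsub>G\<^esub> h) \<otimes>\<^bsub>R\<^esub> \<sigma> (k \<otimes>\<^bsub>G\<^esub> inv\<^bsub>G\<^esub> h) s"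
proof -
  let ?l = "k \<otimes>\<^bsub>G\<^esub> inv\<^bsub>G\<^esub> h"
  let ?A = "insert ?l (supp x)"
  let ?t = "\<lambda>g. x g \<otimes>\<^bsub>R\<^esub> \<sigma> g s"
  have AG: "g \<in> carrier G" if "g \<in> ?A" for g
    using that h k supp_subset by auto
  have t: "?t g \<in> carrier R" if "g \<in> carrier G" for g
    using that x s by (simp add: \<sigma>_closed S_closed)
  have "(x \<otimes>\<^bsub>S\<^esub> skew_monom G R s h) k =
      (\<Oplus>\<^bsub>R\<^esub>g \<in> ?A. x g \<otimes>\<^bsub>R\<^esub> \<sigma> g (skew_monom G R s h (inv\<^bsub>G\<^esub> g \<otimes>\<^bsub>G\<^esub> k)))"
    using x s k AG S_finite[OF x] by (intro S_mult_apply skew_monom_closed) auto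
  also have "\<dots> = (\<Oplus>\<^bsub>R\<^esub>g \<in> ?A. if ?l = g then ?t g else \<zero>\<^bsub>R\<^esub>)"
  proof (rule R.finsum_cong')
    fix g assume "g \<in> ?A"
    then have g: "g \<in> carrier G" by (rule AG)
    have "inv\<^bsub>G\<^esub> g \<otimes>\<^bsub>G\<^esub> k = h \<longleftrightarrow> ?l = g"
      using g h k by (metis G.inv_closed G.inv_solve_left G.inv_solve_right)
    then show "x g \<otimes>\<^bsub>R\<^esub> \<sigma> g (skew_monom G R s h (inv\<^bsub>G\<^esub> g \<otimes>\<^bsub>G\<^esub> k)) =
        (if ?l = g then ?t g else \<zero>\<^bsub>R\<^esub>)"
      using g k S_closed[OF x g] by (simp add: skew_monom_apply \<sigma>_zero)
  qed (use AG t in auto)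
  also have "\<dots> = ?t ?l"
    using S_finite[OF x] AG t by (intro R.finsum_singleton) auto
  finally show ?thesis .
qed

lemma coeff_embedding: "ring_hom_ring R S (\<lambda>r. skew_monom G R r \<one>\<^bsub>G\<^esub>)"
proof (rule ring_hom_ringI[OF R.ring_axioms ring_S])
  fix r s assume rs: "r \<in> carrier R" "s \<in> carrier R"
  show "skew_monom G R (r \<otimes>\<^bsub>R\<^esub> s) \<one>\<^bsub>G\<^esub> =
      skew_monom G R r \<one>\<^bsub>G\<^esub> \<otimes>\<^bsub>S\<^esub> skew_monom G R s \<one>\<^bsub>G\<^esub>"
    using rs by (simp add: skew_monom_mult \<sigma>_one)
  show "skew_monom G R (r \<oplus>\<^bsub>R\<^esub> s) \<one>\<^bsub>G\<^esub> =
      skew_monom G R r \<one>\<^bsub>G\<^esub> \<oplus>\<^bsub>S\<^esub> skew_monom G R s \<one>\<^bsub>G\<^esub>"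
    using rs by (intro S_eqI S_add_closed skew_monom_closed)
      (auto simp: S_add_apply skew_monom_apply)
qed (simp_all add: skew_monom_closed S_one)

lemma subring_coeff_ring: "subring (skew_coeff_ring R G) S"
  unfolding skew_coeff_ring_def
  by (rule ring_hom_ring.img_is_subring[OF coeff_embedding R.carrier_is_subring])

section \<open>Passing between ideals of the two rings\<close>

lemma coeff_ideal:
  assumes J: "ideal J R" and inv: "\<And>g. g \<in> carrier G \<Longrightarrow> \<sigma> g ` J \<subseteq> J"
  shows "ideal {x \<in> carrier S. \<forall>g \<in> carrier G. x g \<in> J} S" (is "ideal ?I S")
proof -
  interpret J: ideal J R by (rule J)
  have product: "a \<otimes>\<^bsub>S\<^esub> b \<in> ?I"
    if ab: "a \<in> carrier S" "b \<in> carrier S" "a \<in> ?I \<or> b \<in> ?I" for a b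
  proof -
    have "(a \<otimes>\<^bsub>S\<^esub> b) k \<in> J" if k: "k \<in> carrier G" for k
    proof -
      have "(a \<otimes>\<^bsub>S\<^esub> b) k =
          (\<Oplus>\<^bsub>R\<^esub>g \<in> supp a. a g \<otimes>\<^bsub>R\<^esub> \<sigma> g (b (inv\<^bsub>G\<^esub> g \<otimes>\<^bsub>G\<^esub> k)))"
        using ab k S_finite supp_subset by (intro S_mult_apply) auto
      also have "\<dots> \<in> J"
      proof (rule J.finsum_in_ideal)
        fix g assume "g \<in> supp a"
        then have g: "g \<in> carrier G" using supp_subset by auto
        have gk: "inv\<^bsub>G\<^esub> g \<otimes>\<^bsub>G\<^esub> k \<in> carrier G" using g k by simp
        have closed: "a g \<in> carrier R" "\<sigma> g (b (inv\<^bsub>G\<^esub> g \<otimes>\<^bsub>G\<^esub> k)) \<in> carrier R"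
          using ab g gk by (simp_all add: \<sigma>_closed S_closed)
        from ab(3) have "a g \<in> J \<or> \<sigma> g (b (inv\<^bsub>G\<^esub> g \<otimes>\<^bsub>G\<^esub> k)) \<in> J"
          using g gk inv[OF g] by auto
        then show "a g \<otimes>\<^bsub>R\<^esub> \<sigma> g (b (inv\<^bsub>G\<^esub> g \<otimes>\<^bsub>G\<^esub> k)) \<in> J"
          using closed J.I_l_closed J.I_r_closed by blast
      qed
      finally show ?thesis .
    qed
    then show ?thesis using ab by (simp add: S_mult_closed)
  qed
  show ?thesis
  proof (rule S.ideal_if_closed)
    show "\<zero>\<^bsub>S\<^esub> \<in> ?I" by (simp add: S_zero_apply)
    show "a \<oplus>\<^bsub>S\<^esub> b \<in> ?I" if "a \<in> ?I" "b \<in> ?I" for a b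
      using that by (auto simp: S_add_apply)
    show "y \<otimes>\<^bsub>S\<^esub> a \<in> ?I" if "a \<in> ?I" "y \<in> carrier S" for a y
      using that by (intro product) auto
    show "a \<otimes>\<^bsub>S\<^esub> y \<in> ?I" if "a \<in> ?I" "y \<in> carrier S" for a y
      using that by (intro product) auto
  qed auto
qed

lemma contracted_ideal:
  assumes I: "ideal I S"
  shows "ideal {r \<in> carrier R. skew_monom G R r \<one>\<^bsub>G\<^esub> \<in> I} R"
  using ring_hom_ring.ideal_vimage[OF coeff_embedding I] .

text \<open>
  The contraction is stable under \<open>\<sigma>\<^sub>g\<close> because \<open>\<sigma>\<^sub>g\<close> becomes conjugation by \<open>u\<^sub>g\<close> in the
  skew group ring.
\<close>

lemma contracted_ideal_invariant:
  assumes I: "ideal I S" and g: "g \<in> carrier G"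
    and r: "r \<in> carrier R" "skew_monom G R r \<one>\<^bsub>G\<^esub> \<in> I"
  shows "skew_monom G R (\<sigma> g r) \<one>\<^bsub>G\<^esub> \<in> I"
proof -
  interpret I: ideal I S by (rule I)
  interpret h: ring_hom_ring R R "\<sigma> g" by (rule \<sigma>_ring_hom_ring[OF g])
  let ?u = "skew_monom G R \<one>\<^bsub>R\<^esub>"
  have "?u g \<otimes>\<^bsub>S\<^esub> skew_monom G R r \<one>\<^bsub>G\<^esub> \<otimes>\<^bsub>S\<^esub> ?u (inv\<^bsub>G\<^esub> g) =
      skew_monom G R (\<sigma> g r) \<one>\<^bsub>G\<^esub>"
    using g r by (simp add: skew_monom_mult)
  moreover have "?u g \<otimes>\<^bsub>S\<^esub> skew_monom G R r \<one>\<^bsub>G\<^esub> \<otimes>\<^bsub>S\<^esub> ?u (inv\<^bsub>G\<^esub> g) \<in> I"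
    by (intro I.I_l_closed I.I_r_closed skew_monom_closed r R.one_closed)
  ultimately show ?thesis by simp
qed

text \<open>
  For \<open>J\<close> a \<open>G\<close>-invariant ideal, the ideal of elements with coefficients in \<open>J\<close> is trivial only
  if \<open>J\<close> is.
\<close>

lemma G_simple_if_simple:
  assumes simple: "simple_ring S"
  shows "G_simple G \<sigma> R"
  unfolding G_simple_def
proof (intro conjI allI impI R.ring_axioms)
  fix J assume J: "ideal J R \<and> (\<forall>g\<in>carrier G. \<sigma> g ` J \<subseteq> J)"
  then interpret J: ideal J R by simp
  let ?I = "{x \<in> carrier S. \<forall>g \<in> carrier G. x g \<in> J}"
  have "ideal ?I S" using J by (intro coeff_ideal) auto
  then consider "?I = {\<zero>\<^bsub>S\<^esub>}" | "?I = carrier S"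
    using simple unfolding simple_ring_def by blast
  then show "J = {\<zero>\<^bsub>R\<^esub>} \<or> J = carrier R"
  proof cases
    case 1
    have "r = \<zero>\<^bsub>R\<^esub>" if r: "r \<in> J" for r
    proof -
      have "skew_monom G R r \<one>\<^bsub>G\<^esub> \<in> ?I"
        using r by (simp add: skew_monom_closed skew_monom_apply)
      then have "skew_monom G R r \<one>\<^bsub>G\<^esub> \<one>\<^bsub>G\<^esub> = \<zero>\<^bsub>S\<^esub> \<one>\<^bsub>G\<^esub>"
        using 1 by (metis singletonD)
      then show ?thesis by (simp add: skew_monom_apply S_zero_apply)
    qed
    then show ?thesis by auto
  next
    case 2
    then have "\<one>\<^bsub>S\<^esub> \<one>\<^bsub>G\<^esub> \<in> J" by blast
    then have "\<one>\<^bsub>R\<^esub> \<in> J" by (simp add: S_one skew_monom_apply)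
    then show ?thesis using J.one_imp_carrier by simp
  qed
qed

section \<open>The action on the coefficient ring\<close>

text \<open>
  This is the left module \<open>S / \<Sum>\<^sub>g S (u\<^sub>g - 1)\<close> of the skew group ring \<open>S\<close>: each \<open>u\<^sub>g\<close> on the right is
  set to \<open>1\<close>, so that the class of \<open>(a u\<^sub>g) s = a \<sigma>\<^sub>g(s) u\<^sub>g\<close> is that of \<open>a \<sigma>\<^sub>g(s)\<close>.
\<close>

definition act :: "('g \<Rightarrow> 'r) \<Rightarrow> 'r \<Rightarrow> 'r"
  where "act a s = (\<Oplus>\<^bsub>R\<^esub>g \<in> supp a. a g \<otimes>\<^bsub>R\<^esub> \<sigma> g s)"

lemma act_eq:
  assumes a: "a \<in> carrier S" and s: "s \<in> carrier R"
    and A: "finite A" "supp a \<subseteq> A" "A \<subseteq> carrier G"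
  shows "act a s = (\<Oplus>\<^bsub>R\<^esub>g \<in> A. a g \<otimes>\<^bsub>R\<^esub> \<sigma> g s)"
  unfolding act_def
proof (rule R.add.finprod_mono_neutral_cong_left)
  fix g assume "g \<in> A - supp a"
  then have "g \<in> carrier G" "a g = \<zero>\<^bsub>R\<^esub>"
    using A(3) by (auto simp: skew_support_def)
  then show "a g \<otimes>\<^bsub>R\<^esub> \<sigma> g s = \<zero>\<^bsub>R\<^esub>"
    using s by (simp add: \<sigma>_closed)
qed (use A s S_closed[OF a] in \<open>auto simp: \<sigma>_closed subset_iff\<close>)

lemma act_closed:
  assumes "a \<in> carrier S" "s \<in> carrier R"
  shows "act a s \<in> carrier R"
  unfolding act_def using assms(2) supp_subset[of a] S_closed[OF assms(1)]
  by (intro R.finsum_closed) (auto simp: \<sigma>_closed)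

lemma act_skew_monom:
  assumes "r \<in> carrier R" "s \<in> carrier R" "g \<in> carrier G"
  shows "act (skew_monom G R r g) s = r \<otimes>\<^bsub>R\<^esub> \<sigma> g s"
proof -
  have "act (skew_monom G R r g) s = (\<Oplus>\<^bsub>R\<^esub>h \<in> {g}. skew_monom G R r g h \<otimes>\<^bsub>R\<^esub> \<sigma> h s)"
    using assms skew_monom_supp[of r g] by (intro act_eq skew_monom_closed) auto
  then show ?thesis using assms by (simp add: skew_monom_apply \<sigma>_closed)
qed

lemma act_zero_left: "act \<zero>\<^bsub>S\<^esub> s = \<zero>\<^bsub>R\<^esub>"
  using supp_empty_iff[of "\<zero>\<^bsub>S\<^esub>"] by (simp add: act_def)

lemma act_zero_right:
  assumes "a \<in> carrier S"
  shows "act a \<zero>\<^bsub>R\<^esub> = \<zero>\<^bsub>R\<^esub>"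
  unfolding act_def using assms supp_subset[of a]
  by (intro R.add.finprod_one_eqI) (auto simp: \<sigma>_zero S_closed)

lemma act_add:
  assumes a: "a \<in> carrier S" and b: "b \<in> carrier S" and s: "s \<in> carrier R"
  shows "act (a \<oplus>\<^bsub>S\<^esub> b) s = act a s \<oplus>\<^bsub>R\<^esub> act b s"
proof -
  let ?A = "supp a \<union> supp b"
  have A: "finite ?A" using a b S_finite by simp
  have AG: "g \<in> carrier G" if "g \<in> ?A" for g using that supp_subset by auto
  have sub: "supp (a \<oplus>\<^bsub>S\<^esub> b) \<subseteq> ?A" by (auto simp: skew_support_def S_add_apply)
  have "act (a \<oplus>\<^bsub>S\<^esub> b) s = (\<Oplus>\<^bsub>R\<^esub>g \<in> ?A. (a \<oplus>\<^bsub>S\<^esub> b) g \<otimes>\<^bsub>R\<^esub> \<sigma> g s)"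
    using a b s A AG sub by (intro act_eq) auto
  also have "\<dots> = (\<Oplus>\<^bsub>R\<^esub>g \<in> ?A. a g \<otimes>\<^bsub>R\<^esub> \<sigma> g s \<oplus>\<^bsub>R\<^esub> b g \<otimes>\<^bsub>R\<^esub> \<sigma> g s)"
    using AG s \<sigma>_closed S_closed[OF a] S_closed[OF b]
    by (intro R.finsum_cong') (auto simp: S_add_apply R.l_distr)
  also have "\<dots> = (\<Oplus>\<^bsub>R\<^esub>g \<in> ?A. a g \<otimes>\<^bsub>R\<^esub> \<sigma> g s) \<oplus>\<^bsub>R\<^esub> (\<Oplus>\<^bsub>R\<^esub>g \<in> ?A. b g \<otimes>\<^bsub>R\<^esub> \<sigma> g s)"
    using AG s \<sigma>_closed S_closed[OF a] S_closed[OF b] by (intro R.finsum_addf) auto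
  also have "\<dots> = act a s \<oplus>\<^bsub>R\<^esub> act b s"
    using a b s A AG by (simp add: act_eq[of a s ?A] act_eq[of b s ?A] subset_iff)
  finally show ?thesis .
qed

text \<open>
  Both sides equal the double sum of \<open>a\<^sub>g \<sigma>\<^sub>g(b\<^sub>h) \<sigma>\<^sub>g\<^sub>h(s)\<close>: the right-hand side because
  \<open>\<sigma>\<^sub>g(b\<^sub>h \<sigma>\<^sub>h(s)) = \<sigma>\<^sub>g(b\<^sub>h) \<sigma>\<^sub>g\<^sub>h(s)\<close>, the left-hand side by grouping the terms according to
  \<open>k = g h\<close>.
\<close>

lemma act_mult:
  assumes a: "a \<in> carrier S" and b: "b \<in> carrier S" and s: "s \<in> carrier R"
  shows "act (a \<otimes>\<^bsub>S\<^esub> b) s = act a (act b s)"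
proof -
  define X where "X = (\<lambda>(g, h). g \<otimes>\<^bsub>G\<^esub> h) ` (supp a \<times> supp b)"
  have X: "finite X" "X \<subseteq> carrier G" "supp (a \<otimes>\<^bsub>S\<^esub> b) \<subseteq> X"
    using S_mult_supp[OF a b] supp_subset[of a] supp_subset[of b] S_finite a b
    by (auto simp: X_def)
  have xX: "x \<in> carrier G" if "x \<in> X" for x using that X by auto
  have sa: "g \<in> carrier G" if "g \<in> supp a" for g using that supp_subset by auto
  have ca: "a g \<in> carrier R" if "g \<in> carrier G" for g using that a by (intro S_closed)
  have fa: "finite (supp a)" using a by (rule S_finite)
  let ?t = "\<lambda>x. \<sigma> x s"
  let ?u = "\<lambda>g x. \<sigma> g (b (inv\<^bsub>G\<^esub> g \<otimes>\<^bsub>G\<^esub> x))"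
  have t: "?t x \<in> carrier R" if "x \<in> carrier G" for x
    using that s by (intro \<sigma>_closed)
  have u: "?u g x \<in> carrier R" if "g \<in> carrier G" "x \<in> carrier G" for g x
    using that b by (intro \<sigma>_closed S_closed) auto
  have "act (a \<otimes>\<^bsub>S\<^esub> b) s = (\<Oplus>\<^bsub>R\<^esub>x\<in>X. (a \<otimes>\<^bsub>S\<^esub> b) x \<otimes>\<^bsub>R\<^esub> ?t x)"
    using a b s X by (intro act_eq S_mult_closed)
  also have "\<dots> = (\<Oplus>\<^bsub>R\<^esub>x\<in>X. \<Oplus>\<^bsub>R\<^esub>g\<in>supp a. a g \<otimes>\<^bsub>R\<^esub> (?u g x \<otimes>\<^bsub>R\<^esub> ?t x))"
  proof (rule R.finsum_cong')
    fix x assume x: "x \<in> X"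
    have "(a \<otimes>\<^bsub>S\<^esub> b) x \<otimes>\<^bsub>R\<^esub> ?t x = (\<Oplus>\<^bsub>R\<^esub>g\<in>supp a. a g \<otimes>\<^bsub>R\<^esub> ?u g x) \<otimes>\<^bsub>R\<^esub> ?t x"
      using a b fa supp_subset xX[OF x] by (subst S_mult_apply[where A = "supp a"]) auto
    also have "\<dots> = (\<Oplus>\<^bsub>R\<^esub>g\<in>supp a. a g \<otimes>\<^bsub>R\<^esub> ?u g x \<otimes>\<^bsub>R\<^esub> ?t x)"
      using fa xX[OF x] sa ca t u by (intro R.finsum_ldistr) auto
    also have "\<dots> = (\<Oplus>\<^bsub>R\<^esub>g\<in>supp a. a g \<otimes>\<^bsub>R\<^esub> (?u g x \<otimes>\<^bsub>R\<^esub> ?t x))"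
      using xX[OF x] sa ca t u by (intro R.finsum_cong') (auto simp: R.m_assoc)
    finally show "(a \<otimes>\<^bsub>S\<^esub> b) x \<otimes>\<^bsub>R\<^esub> ?t x =
      (\<Oplus>\<^bsub>R\<^esub>g\<in>supp a. a g \<otimes>\<^bsub>R\<^esub> (?u g x \<otimes>\<^bsub>R\<^esub> ?t x))" .
  qed (use xX sa ca t u in \<open>auto intro!: R.finsum_closed\<close>)
  also have "\<dots> = (\<Oplus>\<^bsub>R\<^esub>g\<in>supp a. \<Oplus>\<^bsub>R\<^esub>x\<in>X. a g \<otimes>\<^bsub>R\<^esub> (?u g x \<otimes>\<^bsub>R\<^esub> ?t x))"
    using X fa xX sa ca t u by (intro R.finsum_swap) auto
  also have "\<dots> = (\<Oplus>\<^bsub>R\<^esub>g\<in>supp a. a g \<otimes>\<^bsub>R\<^esub> \<sigma> g (act b s))"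
  proof (rule R.finsum_cong')
    fix g assume g: "g \<in> supp a"
    then have gG: "g \<in> carrier G" by (rule sa)
    interpret h: ring_hom_ring R R "\<sigma> g" by (rule \<sigma>_ring_hom_ring[OF gG])
    define Y where "Y = (\<lambda>x. inv\<^bsub>G\<^esub> g \<otimes>\<^bsub>G\<^esub> x) ` X"
    have inj: "inj_on (\<lambda>x. g \<otimes>\<^bsub>G\<^esub> x) Y"
      using gG xX by (auto simp: Y_def inj_on_def)
    have YX: "(\<lambda>x. g \<otimes>\<^bsub>G\<^esub> x) ` Y = X"
      using gG xX by (auto simp: Y_def image_image G.m_assoc[symmetric])
    have Y: "finite Y" "Y \<subseteq> carrier G" using X gG by (auto simp: Y_def)
    have yG: "y \<in> carrier G" if "y \<in> Y" for y using that Y by auto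
    have bY: "supp b \<subseteq> Y"
    proof
      fix h assume h: "h \<in> supp b"
      then have "h \<in> carrier G" using supp_subset by auto
      then have "inv\<^bsub>G\<^esub> g \<otimes>\<^bsub>G\<^esub> (g \<otimes>\<^bsub>G\<^esub> h) = h"
        using gG by (simp add: G.m_assoc[symmetric])
      moreover have "g \<otimes>\<^bsub>G\<^esub> h \<in> X" using g h by (auto simp: X_def)
      ultimately show "h \<in> Y" unfolding Y_def by force
    qed
    let ?v = "\<lambda>y. b y \<otimes>\<^bsub>R\<^esub> \<sigma> y s"
    have v: "?v y \<in> carrier R" if "y \<in> carrier G" for y
      using that s S_closed[OF b] by (simp add: \<sigma>_closed)
    have "(\<Oplus>\<^bsub>R\<^esub>x\<in>X. a g \<otimes>\<^bsub>R\<^esub> (?u g x \<otimes>\<^bsub>R\<^esub> ?t x)) =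
        a g \<otimes>\<^bsub>R\<^esub> (\<Oplus>\<^bsub>R\<^esub>x\<in>X. ?u g x \<otimes>\<^bsub>R\<^esub> ?t x)"
      using X gG xX ca t u by (intro R.finsum_rdistr[symmetric]) auto
    also have "(\<Oplus>\<^bsub>R\<^esub>x\<in>X. ?u g x \<otimes>\<^bsub>R\<^esub> ?t x) =
        (\<Oplus>\<^bsub>R\<^esub>y\<in>Y. ?u g (g \<otimes>\<^bsub>G\<^esub> y) \<otimes>\<^bsub>R\<^esub> ?t (g \<otimes>\<^bsub>G\<^esub> y))"
      unfolding YX[symmetric] using inj gG yG t u by (intro R.finsum_reindex) auto
    also have "\<dots> = (\<Oplus>\<^bsub>R\<^esub>y\<in>Y. \<sigma> g (?v y))"
    proof (rule R.finsum_cong')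
      fix y assume "y \<in> Y"
      then have y: "y \<in> carrier G" by (rule yG)
      have 1: "inv\<^bsub>G\<^esub> g \<otimes>\<^bsub>G\<^esub> (g \<otimes>\<^bsub>G\<^esub> y) = y"
        using y gG by (simp add: G.m_assoc[symmetric])
      show "?u g (g \<otimes>\<^bsub>G\<^esub> y) \<otimes>\<^bsub>R\<^esub> ?t (g \<otimes>\<^bsub>G\<^esub> y) = \<sigma> g (?v y)"
        unfolding 1 using y gG s S_closed[OF b y] by (simp add: \<sigma>_mult_group \<sigma>_closed)
    qed (use yG v gG \<sigma>_closed in auto)
    also have "\<dots> = \<sigma> g (\<Oplus>\<^bsub>R\<^esub>y\<in>Y. ?v y)"
      using v yG by (subst h.hom_finsum) (auto simp: comp_def)
    also have "(\<Oplus>\<^bsub>R\<^esub>y\<in>Y. ?v y) = act b s"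
      using b s Y bY by (intro act_eq[symmetric])
    finally show "(\<Oplus>\<^bsub>R\<^esub>x\<in>X. a g \<otimes>\<^bsub>R\<^esub> (?u g x \<otimes>\<^bsub>R\<^esub> ?t x)) =
      a g \<otimes>\<^bsub>R\<^esub> \<sigma> g (act b s)" .
  qed (use sa ca act_closed[OF b s] \<sigma>_closed in auto)
  finally show ?thesis by (simp add: act_def[of a])
qed

lemma annihilator_ideal:
  "ideal {x \<in> carrier S. \<forall>s \<in> carrier R. act x s = \<zero>\<^bsub>R\<^esub>} S" (is "ideal ?I S")
proof (rule S.ideal_if_closed)
  show "\<zero>\<^bsub>S\<^esub> \<in> ?I" by (simp add: act_zero_left)
  show "a \<oplus>\<^bsub>S\<^esub> b \<in> ?I" if "a \<in> ?I" "b \<in> ?I" for a b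
    using that by (simp add: act_add)
  show "y \<otimes>\<^bsub>S\<^esub> a \<in> ?I" if "a \<in> ?I" "y \<in> carrier S" for a y
    using that by (simp add: act_mult act_zero_right)
  show "a \<otimes>\<^bsub>S\<^esub> y \<in> ?I" if "a \<in> ?I" "y \<in> carrier S" for a y
    using that by (simp add: act_mult act_closed)
qed auto

text \<open>
  The annihilator is \<open>0\<close> or everything.  In the second case \<open>1\<close> acts as \<open>0\<close> and as the identity,
  so \<open>R\<close> and with it the skew group ring are zero rings, where any two elements agree.
\<close>

lemma faithful_action:
  assumes simple: "simple_ring S"
    and xy: "x \<in> carrier S" "y \<in> carrier S"
    and eq: "\<And>s. s \<in> carrier R \<Longrightarrow> act x s = act y s"
  shows "x = y"
proof -
  let ?I = "{x \<in> carrier S. \<forall>s \<in> carrier R. act x s = \<zero>\<^bsub>R\<^esub>}"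
  consider "?I = {\<zero>\<^bsub>S\<^esub>}" | "?I = carrier S"
    using simple annihilator_ideal unfolding simple_ring_def by blast
  then show ?thesis
  proof cases
    case 1
    have "act (x \<ominus>\<^bsub>S\<^esub> y) s = \<zero>\<^bsub>R\<^esub>" if s: "s \<in> carrier R" for s
    proof -
      have "act (x \<ominus>\<^bsub>S\<^esub> y) s \<oplus>\<^bsub>R\<^esub> act y s = act (x \<ominus>\<^bsub>S\<^esub> y \<oplus>\<^bsub>S\<^esub> y) s"
        using xy s by (simp add: act_add)
      also have "x \<ominus>\<^bsub>S\<^esub> y \<oplus>\<^bsub>S\<^esub> y = x"
        using xy by (simp add: a_minus_def S.a_assoc S.l_neg)
      finally show ?thesis
        using eq[OF s] xy s by (simp add: act_closed)
    qed
    then have "x \<ominus>\<^bsub>S\<^esub> y \<in> ?I" using xy by simp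
    then show ?thesis using 1 xy by simp
  next
    case 2
    then have "\<one>\<^bsub>S\<^esub> \<in> ?I" by simp
    then have "act \<one>\<^bsub>S\<^esub> \<one>\<^bsub>R\<^esub> = \<zero>\<^bsub>R\<^esub>" by simp
    then have "\<one>\<^bsub>R\<^esub> = \<zero>\<^bsub>R\<^esub>"
      by (simp add: S_one act_skew_monom \<sigma>_one)
    then have "r = \<zero>\<^bsub>R\<^esub>" if "r \<in> carrier R" for r
      using that R.one_zeroD by blast
    then show ?thesis
      using xy S_closed[OF xy(1)] S_closed[OF xy(2)] by (intro S_eqI) metis+
  qed
qed

end

section \<open>Commutative coefficients\<close>

locale comm_skew_group_ring_data = skew_group_ring_data G R \<sigma> + R: cring R
  for G :: "('g, 'n) monoid_scheme" (structure) and R :: "('r, 'm) ring_scheme" (structure)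
    and \<sigma> :: "'g \<Rightarrow> 'r \<Rightarrow> 'r"
begin

lemma subcring_coeff_ring: "subcring (skew_coeff_ring R G) S"
  using subring_coeff_ring
  by (rule S.subcringI) (auto simp: skew_coeff_ring_def skew_monom_mult \<sigma>_one R.m_comm)

lemma maximal_commutative_if_simple:
  assumes simple: "simple_ring S"
  shows "maximal_commutative (skew_coeff_ring R G) S"
  unfolding maximal_commutative_def
proof (intro conjI ballI impI subcring_coeff_ring)
  fix x assume x: "x \<in> carrier S"
    and comm: "\<forall>s\<in>skew_coeff_ring R G. x \<otimes>\<^bsub>S\<^esub> s = s \<otimes>\<^bsub>S\<^esub> x"
  have zero: "x g = \<zero>\<^bsub>R\<^esub>" if g: "g \<in> carrier G" "g \<noteq> \<one>\<^bsub>G\<^esub>" for g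
  proof -
    have c: "x g \<in> carrier R" using x g by (simp add: S_closed)
    \<comment> \<open>Comparing the coefficients of \<open>x s = s x\<close> at \<open>g\<close> shows that \<open>x\<^sub>g u\<^sub>g\<close> acts like \<open>x\<^sub>g u\<^sub>e\<close>.\<close>
    have "act (skew_monom G R (x g) g) s = act (skew_monom G R (x g) \<one>\<^bsub>G\<^esub>) s"
      if s: "s \<in> carrier R" for s
    proof -
      have "(x \<otimes>\<^bsub>S\<^esub> skew_monom G R s \<one>\<^bsub>G\<^esub>) g = (skew_monom G R s \<one>\<^bsub>G\<^esub> \<otimes>\<^bsub>S\<^esub> x) g"
        using comm s by (auto simp: skew_coeff_ring_def)
      then have "x g \<otimes>\<^bsub>R\<^esub> \<sigma> g s = s \<otimes>\<^bsub>R\<^esub> x g"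
        using x s g c by (simp add: mult_skew_monom_apply skew_monom_mult_apply \<sigma>_one)
      then show ?thesis
        using s g c by (simp add: act_skew_monom \<sigma>_one R.m_comm)
    qed
    then have "skew_monom G R (x g) g = skew_monom G R (x g) \<one>\<^bsub>G\<^esub>"
      using c by (intro faithful_action[OF simple] skew_monom_closed)
    then have "skew_monom G R (x g) g g = skew_monom G R (x g) \<one>\<^bsub>G\<^esub> g" by simp
    then show ?thesis using g by (simp add: skew_monom_apply)
  qed
  have "x = skew_monom G R (x \<one>\<^bsub>G\<^esub>) \<one>\<^bsub>G\<^esub>"
    using x zero by (intro S_eqI skew_monom_closed) (auto simp: skew_monom_apply S_closed)
  then show "x \<in> skew_coeff_ring R G"
    using x by (auto simp: skew_coeff_ring_def S_closed)
qed

text \<open>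
  A nonzero element of least support, translated so that the identity of \<open>G\<close> lies in its support,
  commutes with \<open>R\<close>: a commutator with \<open>r \<in> R\<close> stays in the ideal and loses the coefficient at
  the identity.  Maximal commutativity then puts the element into \<open>R\<close>.
\<close>

lemma ideal_meets_coeff_ring:
  assumes max: "maximal_commutative (skew_coeff_ring R G) S"
    and I: "ideal I S" "I \<noteq> {\<zero>\<^bsub>S\<^esub>}"
  obtains r where "r \<in> carrier R" "r \<noteq> \<zero>\<^bsub>R\<^esub>" "skew_monom G R r \<one>\<^bsub>G\<^esub> \<in> I"
proof -
  interpret I: ideal I S by (rule I)
  obtain z where z: "z \<in> I \<and> z \<noteq> \<zero>\<^bsub>S\<^esub>" using I(2) I.zero_closed by blast
  obtain x where x: "x \<in> I" "x \<noteq> \<zero>\<^bsub>S\<^esub>"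
    and min: "\<And>y. y \<in> I \<Longrightarrow> y \<noteq> \<zero>\<^bsub>S\<^esub> \<Longrightarrow> card (supp x) \<le> card (supp y)"
    using ex_has_least_nat[where P = "\<lambda>x. x \<in> I \<and> x \<noteq> \<zero>\<^bsub>S\<^esub>", OF z, of "\<lambda>x. card (supp x)"]
    by auto
  have xS: "x \<in> carrier S" using x(1) by (rule I.Icarr)
  obtain h where h: "h \<in> carrier G" "x h \<noteq> \<zero>\<^bsub>R\<^esub>"
    using x(2) supp_empty_iff[OF xS] by (auto simp: skew_support_def)
  define y where "y = x \<otimes>\<^bsub>S\<^esub> skew_monom G R \<one>\<^bsub>R\<^esub> (inv\<^bsub>G\<^esub> h)"
  have yI: "y \<in> I"
    unfolding y_def using x(1) by (intro I.I_r_closed skew_monom_closed) auto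
  then have yS: "y \<in> carrier S" by (rule I.Icarr)
  have y_apply: "y k = x (k \<otimes>\<^bsub>G\<^esub> h)" if k: "k \<in> carrier G" for k
  proof -
    interpret h: ring_hom_ring R R "\<sigma> (k \<otimes>\<^bsub>G\<^esub> h)" using k h by (intro \<sigma>_ring_hom_ring) simp
    show ?thesis
      using xS h k by (simp add: y_def mult_skew_monom_apply S_closed)
  qed
  have y1: "y \<one>\<^bsub>G\<^esub> \<noteq> \<zero>\<^bsub>R\<^esub>" using h by (simp add: y_apply)
  \<comment> \<open>Right translation by \<open>h\<close> maps the support of \<open>y\<close> injectively into that of \<open>x\<close>, so \<open>y\<close>
    inherits minimality.\<close>
  have "card (supp y) \<le> card (supp x)"
  proof (rule card_inj_on_le)
    show "inj_on (\<lambda>k. k \<otimes>\<^bsub>G\<^esub> h) (supp y)"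
      using h(1) supp_subset[of y] by (auto simp: inj_on_def subset_iff)
    show "(\<lambda>k. k \<otimes>\<^bsub>G\<^esub> h) ` supp y \<subseteq> supp x"
      using h y_apply by (auto simp: skew_support_def)
  qed (rule S_finite[OF xS])
  then have ymin: "card (supp y) \<le> card (supp z)" if "z \<in> I" "z \<noteq> \<zero>\<^bsub>S\<^esub>" for z
    using min[OF that] by simp
  have "y \<otimes>\<^bsub>S\<^esub> skew_monom G R r \<one>\<^bsub>G\<^esub> = skew_monom G R r \<one>\<^bsub>G\<^esub> \<otimes>\<^bsub>S\<^esub> y"
    if r: "r \<in> carrier R" for r
  proof -
    let ?r = "skew_monom G R r \<one>\<^bsub>G\<^esub>"
    let ?z = "y \<otimes>\<^bsub>S\<^esub> ?r \<ominus>\<^bsub>S\<^esub> ?r \<otimes>\<^bsub>S\<^esub> y"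
    have rS: "?r \<in> carrier S" using r by (rule skew_monom_closed)
    have zI: "?z \<in> I"
      unfolding a_minus_def
      using yI rS by (intro I.a_closed I.a_inv_closed I.I_l_closed I.I_r_closed)
    have z_apply: "?z k = y k \<otimes>\<^bsub>R\<^esub> \<sigma> k r \<ominus>\<^bsub>R\<^esub> r \<otimes>\<^bsub>R\<^esub> y k" if k: "k \<in> carrier G" for k
      using k r rS yS
      by (simp add: S_minus_apply mult_skew_monom_apply skew_monom_mult_apply \<sigma>_one S_closed)
    have "?z \<one>\<^bsub>G\<^esub> = \<zero>\<^bsub>R\<^esub>"
      using r yS by (simp add: z_apply \<sigma>_one S_closed R.m_comm)
    moreover have "supp ?z \<subseteq> supp y"
    proof
      fix k assume "k \<in> supp ?z"
      then have k: "k \<in> carrier G" "?z k \<noteq> \<zero>\<^bsub>R\<^esub>" by (auto simp: skew_support_def)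
      then have "y k \<noteq> \<zero>\<^bsub>R\<^esub>" using r by (auto simp: z_apply \<sigma>_closed)
      then show "k \<in> supp y" using k by (simp add: skew_support_def)
    qed
    ultimately have "supp ?z \<subset> supp y"
      using y1 by (auto simp: skew_support_def)
    then have "card (supp ?z) < card (supp y)"
      by (rule psubset_card_mono[OF S_finite[OF yS]])
    then have "?z = \<zero>\<^bsub>S\<^esub>" using ymin[OF zI] by fastforce
    then show ?thesis using yS rS by simp
  qed
  then have "y \<in> skew_coeff_ring R G"
    using max yS unfolding maximal_commutative_def by (auto simp: skew_coeff_ring_def)
  then obtain r where r: "r \<in> carrier R" "y = skew_monom G R r \<one>\<^bsub>G\<^esub>"
    by (auto simp: skew_coeff_ring_def)
  with y1 have "r \<noteq> \<zero>\<^bsub>R\<^esub>" by (simp add: skew_monom_apply)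
  with r yI show ?thesis using that by blast
qed

lemma simple_if_maximal_commutative_G_simple:
  assumes max: "maximal_commutative (skew_coeff_ring R G) S" and G_simple: "G_simple G \<sigma> R"
  shows "simple_ring S"
  unfolding simple_ring_def
proof (intro conjI allI impI ring_S)
  fix I assume I: "ideal I S"
  interpret I: ideal I S by (rule I)
  let ?J = "{r \<in> carrier R. skew_monom G R r \<one>\<^bsub>G\<^esub> \<in> I}"
  show "I = {\<zero>\<^bsub>S\<^esub>} \<or> I = carrier S"
  proof (cases "I = {\<zero>\<^bsub>S\<^esub>}")
    case False
    then have "?J \<noteq> {\<zero>\<^bsub>R\<^esub>}"
      using ideal_meets_coeff_ring[OF max I] by (metis (mono_tags, lifting) mem_Collect_eq singletonD)
    moreover have "\<sigma> g ` ?J \<subseteq> ?J" if "g \<in> carrier G" for g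
      using that contracted_ideal_invariant[OF I] by (auto simp: \<sigma>_closed)
    ultimately have "?J = carrier R"
      using G_simple contracted_ideal[OF I] unfolding G_simple_def by blast
    then have "\<one>\<^bsub>S\<^esub> \<in> I" unfolding S_one using R.one_closed by blast
    then show ?thesis using I.one_imp_carrier by simp
  qed simp
qed

end

theorem theorem6p13:
  fixes G :: "('g, 'n) monoid_scheme"
    and R :: "('r, 'm) ring_scheme"
    and \<sigma> :: "'g \<Rightarrow> 'r \<Rightarrow> 'r"
  assumes "group G"
    and "cring R"
    and "\<sigma> \<in> hom G (ring_AutoGroup R)"
  shows "(maximal_commutative (skew_coeff_ring R G) (skew_group_ring R G \<sigma>) \<and> G_simple G \<sigma> R)
    \<longleftrightarrow> simple_ring (skew_group_ring R G \<sigma>)"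
proof -
  interpret comm_skew_group_ring_data G R \<sigma>
    using assms by (simp add: comm_skew_group_ring_data_def skew_group_ring_data_def
        skew_group_ring_data_axioms_def cring.axioms(1))
  show ?thesis
    using simple_if_maximal_commutative_G_simple maximal_commutative_if_simple G_simple_if_simple
    by blast
qed

end
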